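(* Let $G\colon\mathbb{R}^n\times\mathbb{R}^n\times[0,\infty)\to[0,\infty)$ be a generalized Young function satisfying (H1), (H2) and (H3) (as defined in the context). Let $u\in C^2_c(\mathbb{R}^n)$ and $k\in\{1,\ldots,n\}$. Then $$\lim_{s\uparrow1}(1-s)\,\mathcal{J}^k_{s,G}(u)=\int_{\mathbb{R}^n}H_0\left(x,\left|\frac{\partial u(x)}{\partial x_k}\right|\right)dx,$$ where $$\mathcal{J}^k_{s,G}(u)=\int_{\mathbb{R}^n}\int_{\mathbb{R}}G\left(x,x-he_k,\frac{|u(x-he_k)-u(x)|}{|h|^s}\right)\frac{dh\,dx}{|h|}$$ and $$H_0(x,t)=2\int_0^1G(x,x,tr)\,\frac{dr}{r}.$$
   Context: Let $n\ge 1$ be an integer and $s\in(0,1)$; $e_k$ denotes the $k$-th canonical basis vector of $\mathbb{R}^n$. A generalized Young function is a function $G\colon\mathbb{R}^n\times\mathbb{R}^n\times[0,\infty)\to[0,\infty)$ of the form $G(x,y,t)=\int_0^t g(x,y,\tau)\,d\tau$, where $g\colon\mathbb{R}^n\times\mathbb{R}^n\times[0,\infty)\to[0,\infty)$ satisfies, for every $(x,y)$: (i) $g(x,y,0)=0$ and $g(x,y,t)>0$ for $t>0$; (ii) $t\mapsto g(x,y,t)$ is nondecreasing on $[0,\infty)$; (iii) $t\mapsto g(x,y,t)$ is right continuous on $[0,\infty)$ and $\lim_{t\to\infty}g(x,y,t)=\infty$. It is understood that $(x,y)\mapsto G(x,y,t)$ is measurable for each $t$. Hypotheses: (H1) there exist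 constants $0<C_1\le C_2<\infty$ such that $C_1\le G(x,y,1)\le C_2$ for all $x,y\in\mathbb{R}^n$; (H2) for every $x\in\mathbb{R}^n$ and $t\ge0$, the map $y\mapsto G(x,y,t)$ is continuous on $\mathbb{R}^n$; (H3) there exist constants $1<p^-\le p^+<\infty$ such that $p^-\le \frac{t\,g(x,y,t)}{G(x,y,t)}\le p^+$ for all $x,y\in\mathbb{R}^n$ and $t>0$. $C^2_c(\mathbb{R}^n)$ is the space of real-valued compactly supported $C^2$ functions. *)

theory Defs
  imports "HOL-Analysis.Analysis"
begin

text \<open>
  Functions on $[0,\infty)$ are total functions on \<^typ>\<open>real\<close>; their values at negative arguments
  are unconstrained and never used.  Measurability is Lebesgue measurability.
\<close>

definition generalized_Young ::
  "('a::euclidean_space \<Rightarrow> 'a \<Rightarrow> real \<Rightarrow> real) \<Rightarrow> ('a \<Rightarrow> 'a \<Rightarrow> real \<Rightarrow> real) \<Rightarrow> bool" where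
  "generalized_Young g G \<longleftrightarrow>
     (\<forall>x y. g x y 0 = 0 \<and> (\<forall>t>0. g x y t > 0)) \<and>
     (\<forall>x y. mono_on {0..} (g x y)) \<and>
     (\<forall>x y. (\<forall>t\<ge>0. continuous (at_right t) (g x y)) \<and> filterlim (g x y) at_top at_top) \<and>
     (\<forall>x y. \<forall>t\<ge>0. (g x y has_integral G x y t) {0..t}) \<and>
     (\<forall>t\<ge>0. (\<lambda>(x, y). G x y t) \<in> borel_measurable lebesgue)"

definition hyp_H1 :: "('a::euclidean_space \<Rightarrow> 'a \<Rightarrow> real \<Rightarrow> real) \<Rightarrow> bool" where
  "hyp_H1 G \<longleftrightarrow> (\<exists>C\<^sub>1 C\<^sub>2. 0 < C\<^sub>1 \<and> C\<^sub>1 \<le> C\<^sub>2 \<and> (\<forall>x y. C\<^sub>1 \<le> G x y 1 \<and> G x y 1 \<le> C\<^sub>2))"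

definition hyp_H2 :: "('a::euclidean_space \<Rightarrow> 'a \<Rightarrow> real \<Rightarrow> real) \<Rightarrow> bool" where
  "hyp_H2 G \<longleftrightarrow> (\<forall>x. \<forall>t\<ge>0. continuous_on UNIV (\<lambda>y. G x y t))"

definition hyp_H3 ::
  "('a::euclidean_space \<Rightarrow> 'a \<Rightarrow> real \<Rightarrow> real) \<Rightarrow> ('a \<Rightarrow> 'a \<Rightarrow> real \<Rightarrow> real) \<Rightarrow> bool" where
  "hyp_H3 g G \<longleftrightarrow>
     (\<exists>p q. 1 < p \<and> p \<le> q \<and>
       (\<forall>x y. \<forall>t>0. p \<le> t * g x y t / G x y t \<and> t * g x y t / G x y t \<le> q))"

definition has_partial :: "'n::finite \<Rightarrow> (real^'n \<Rightarrow> real) \<Rightarrow> real^'n \<Rightarrow> bool" where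
  "has_partial k u x \<longleftrightarrow> (\<lambda>h::real. u (x + h *\<^sub>R axis k 1)) field_differentiable (at 0)"

definition partial_deriv :: "'n::finite \<Rightarrow> (real^'n \<Rightarrow> real) \<Rightarrow> real^'n \<Rightarrow> real" where
  "partial_deriv k u x = deriv (\<lambda>h::real. u (x + h *\<^sub>R axis k 1)) 0"

text \<open>All partial derivatives up to order \<open>m\<close> exist everywhere and are continuous.\<close>

primrec C_diff :: "nat \<Rightarrow> (real^'n::finite \<Rightarrow> real) \<Rightarrow> bool" where
  "C_diff 0 u \<longleftrightarrow> continuous_on UNIV u"
| "C_diff (Suc m) u \<longleftrightarrow>
     continuous_on UNIV u \<and> (\<forall>k. (\<forall>x. has_partial k u x) \<and> C_diff m (partial_deriv k u))"

definition C2_compact_support :: "(real^'n::finite \<Rightarrow> real) set" where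
  "C2_compact_support = {u. C_diff 2 u \<and> compact (closure {x. u x \<noteq> 0})}"

text \<open>
  The integrands below are nonnegative, so all integrals take values in \<^typ>\<open>ennreal\<close> and no
  integrability is presupposed.  The conventions \<open>0 powr s = 0\<close> and \<open>a / 0 = 0\<close> only affect the
  null set \<open>h = 0\<close>.
\<close>

definition J_functional ::
  "(real^'n::finite \<Rightarrow> real^'n \<Rightarrow> real \<Rightarrow> real) \<Rightarrow> 'n \<Rightarrow> real \<Rightarrow> (real^'n \<Rightarrow> real) \<Rightarrow> ennreal" where
  "J_functional G k s u =
     (\<integral>\<^sup>+x. (\<integral>\<^sup>+h.
        ennreal (G x (x - h *\<^sub>R axis k 1)
                     (\<bar>u (x - h *\<^sub>R axis k 1) - u x\<bar> / \<bar>h\<bar> powr s) / \<bar>h\<bar>)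
      \<partial>lebesgue) \<partial>lebesgue)"

definition H0 :: "('a \<Rightarrow> 'a \<Rightarrow> real \<Rightarrow> real) \<Rightarrow> 'a \<Rightarrow> real \<Rightarrow> ennreal" where
  "H0 G x t = 2 * (\<integral>\<^sup>+r\<in>{0<..<1}. ennreal (G x x (t * r) / r) \<partial>lebesgue)"

end

theory Submission
  imports Defs
begin

text \<open>
  Everything that happens in the limit happens at small increments, and a substitution makes this
  visible. On \<open>0 < h < 1\<close> put
  \<open>h = r\<^sup>m\<close> with \<open>m = 1/(1 - s)\<close>. Then \<open>(1 - s) dh/h = dr/r\<close> and \<open>h powr (1 - s) = r\<close>, so the argument
  of \<open>G\<close> becomes \<open>r\<close> times the difference quotient of \<open>u\<close> with step \<open>r\<^sup>m\<close>. As \<open>s\<close> tends to 1 the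
  exponent \<open>m\<close> tends to infinity and the step \<open>r\<^sup>m\<close> tends to 0 for each fixed \<open>r < 1\<close>; the integrand
  converges to \<open>G x x (r \<bar>\<partial>\<^sub>k u x\<bar>) / r\<close>. Both signs of \<open>h\<close> contribute equally, which is the factor 2 in
  \<open>H0\<close>.

  Passage to the limit under the integral is dominated convergence in \<open>(x, r)\<close>. The difference quotient
  is bounded by a constant \<open>L\<close>, convexity gives \<open>G x y (r L) \<le> r G x y L\<close>
  (\<open>young_star_shaped\<close>), and \<open>G x y L\<close> is bounded uniformly in \<open>(x, y)\<close> by \<open>hyp_H1\<close> and \<open>hyp_H3\<close>
  (\<open>young_uniformly_bounded\<close>). The integrand is therefore bounded by a constant, and it vanishes for
  \<open>x\<close> outside a bounded set (\<open>near_limit\<close>).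

  The increments \<open>\<bar>h\<bar> \<ge> 1\<close> contribute a quantity bounded uniformly in \<open>s > 1/2\<close>, by Tonelli's theorem
  (\<open>far_integral_bounded\<close>), and the factor \<open>1 - s\<close> removes them.

  Both arguments need measurability of \<open>G\<close> along the lower-dimensional family of pairs
  \<open>(x, x - h e)\<close>. It follows from measurability in \<open>x\<close> and joint continuity in \<open>(y, t)\<close>
  (\<open>young_compose_measurable\<close>).
\<close>

section \<open>Measure-theoretic tools\<close>

text \<open>
  A Caratheodory function is measurable along any measurable \<open>\<phi>\<close>: if \<open>\<phi>\<close> has finite range this is
  a finite case distinction, and simple functions converge to \<open>\<phi>\<close> pointwise.
\<close>

lemma borel_measurable_caratheodory_compose:
  fixes f :: "'a \<Rightarrow> 'b::{metric_space, second_countable_topology} \<Rightarrow> 'c::metric_space"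
  assumes meas: "\<And>y. (\<lambda>x. f x y) \<in> borel_measurable M"
    and cont: "\<And>x. x \<in> space M \<Longrightarrow> continuous_on UNIV (f x)"
    and \<phi>: "\<phi> \<in> borel_measurable M"
  shows "(\<lambda>x. f x (\<phi> x)) \<in> borel_measurable M"
proof -
  obtain F where F: "\<And>i. simple_function M (F i)"
      "\<And>x. x \<in> space M \<Longrightarrow> (\<lambda>i. F i x) \<longlonglongrightarrow> \<phi> x"
    using borel_measurable_implies_sequence_metric[OF \<phi>] by metis
  show ?thesis
  proof (rule borel_measurable_LIMSEQ_metric)
    fix i
    show "(\<lambda>x. f x (F i x)) \<in> borel_measurable M"
    proof (rule measurable_compose_countable'[where f="\<lambda>y x. f x y" and I="F i ` space M"])
      show "F i \<in> measurable M (count_space (F i ` space M))"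
        using F(1)[of i] measurable_count_space_eq2[of "F i ` space M" "F i" M]
        by (auto simp: simple_function_def)
      show "countable (F i ` space M)"
        using F(1)[of i] by (auto simp: simple_function_def countable_finite)
    qed (rule meas)
  next
    fix x assume "x \<in> space M"
    then show "(\<lambda>i. f x (F i x)) \<longlonglongrightarrow> f x (\<phi> x)"
      by (intro continuous_on_tendsto_compose[OF cont] F(2)) auto
  qed
qed

text \<open>
  Off a Borel null set of the product the function agrees with a Borel function, whose sections are
  Borel; almost every section of a null set is null, and Lebesgue measurability does not see
  null sets.
\<close>

lemma borel_measurable_lebesgue_sections:
  fixes f :: "'a::euclidean_space \<times> 'b::euclidean_space \<Rightarrow> real"
  assumes "f \<in> borel_measurable lebesgue"
  shows "AE y in lborel. (\<lambda>x. f (x, y)) \<in> borel_measurable lebesgue"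
proof -
  obtain f' where f': "f' \<in> borel_measurable lborel" "AE z in lborel. f z = f' z"
    using completion_ex_borel_measurable_real[OF assms] by blast
  obtain N where N: "N \<in> null_sets lborel" "{z. f z \<noteq> f' z} \<subseteq> N"
    using f'(2) unfolding eventually_ae_filter by auto
  have Nb: "N \<in> sets (lborel \<Otimes>\<^sub>M lborel)"
    using N(1) unfolding lborel_prod by auto
  have "AE z in (lborel :: 'a measure) \<Otimes>\<^sub>M (lborel :: 'b measure). z \<notin> N"
    unfolding lborel_prod using N(1) by (rule AE_not_in)
  then have "AE x in lborel. AE y in lborel. (x, y) \<notin> N"
    by (rule lborel_pair.AE_pair)
  then have "AE y in lborel. AE x in lborel. (x, y) \<notin> N"
  proof (subst (asm) lborel_pair.AE_commute)
    have "{z \<in> space (lborel \<Otimes>\<^sub>M lborel). (fst z, snd z) \<notin> N} = space (lborel \<Otimes>\<^sub>M lborel) - N"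
      by auto
    also have "\<dots> \<in> sets (lborel \<Otimes>\<^sub>M lborel)"
      using Nb by (rule sets.compl_sets)
    finally show "{z \<in> space (lborel \<Otimes>\<^sub>M lborel). (fst z, snd z) \<notin> N} \<in> sets (lborel \<Otimes>\<^sub>M lborel)" .
  qed
  then show ?thesis
  proof eventually_elim
    case (elim y)
    have "(\<lambda>x. f' (x, y)) \<in> borel_measurable lborel"
      using f'(1) by simp
    then have 1: "(\<lambda>x. f' (x, y)) \<in> borel_measurable lebesgue"
      by (rule measurable_completion)
    have "AE x in lebesgue. f' (x, y) = f (x, y)"
      by (rule AE_completion, rule eventually_mono[OF elim]) (use N(2) in force)
    with 1 show ?case
      by (rule borel_measurable_AE)
  qed
qed

lemma AE_lborel_imp_dense:
  fixes y :: "'a::euclidean_space"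
  assumes "AE z in lborel. P z"
  obtains Y where "\<And>n. P (Y n)" "Y \<longlonglongrightarrow> y"
proof -
  have "negligible {z. \<not> P z}"
  proof -
    obtain N where "N \<in> null_sets lborel" "{z. \<not> P z} \<subseteq> N"
      using assms unfolding eventually_ae_filter by auto
    then show ?thesis
      using null_sets_completionI negligible_iff_null_sets negligible_subset by metis
  qed
  have "y \<in> closure {z. P z}"
  proof (rule ccontr)
    assume "y \<notin> closure {z. P z}"
    moreover have "- closure {z. P z} \<subseteq> {z. \<not> P z}"
      using closure_subset[of "{z. P z}"] by auto
    ultimately show False
      using open_not_negligible[of "- closure {z. P z}"] \<open>negligible {z. \<not> P z}\<close>
        negligible_subset by blast
  qed
  then show thesis
    using that by (auto simp: closure_sequential)
qed

text \<open>
  Folds an integral over the line onto the positive half-line, so that the substitution \<open>h = r\<^sup>m\<close>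
  below needs to be carried out only there.
\<close>

lemma nn_integral_reflect:
  fixes f :: "real \<Rightarrow> ennreal"
  assumes [measurable]: "f \<in> borel_measurable borel"
  shows "(\<integral>\<^sup>+h. f h \<partial>lborel) = (\<integral>\<^sup>+h. (f h + f (- h)) * indicator {0<..} h \<partial>lborel)"
proof -
  have "(\<integral>\<^sup>+h. f h \<partial>lborel)
      = (\<integral>\<^sup>+h. f h * indicator {0<..} h + f h * indicator {..<0} h \<partial>lborel)"
    by (rule nn_integral_cong_AE, rule eventually_mono[OF AE_lborel_singleton[of 0]])
       (simp add: indicator_def)
  also have "\<dots> = (\<integral>\<^sup>+h. f h * indicator {0<..} h \<partial>lborel) + (\<integral>\<^sup>+h. f h * indicator {..<0} h \<partial>lborel)"
    by (rule nn_integral_add) auto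
  also have "(\<integral>\<^sup>+h. f h * indicator {..<0} h \<partial>lborel) = (\<integral>\<^sup>+h. f (- h) * indicator {0<..} h \<partial>lborel)"
    by (subst nn_integral_real_affine[of _ "-1" 0]) (auto intro!: nn_integral_cong split: split_indicator)
  finally show ?thesis
    by (simp add: nn_integral_add[symmetric] distrib_right)
qed

text \<open>
  The change of variables \<open>h = r\<^sup>m\<close>. The condition \<open>1 < m\<close> makes \<open>r \<mapsto> r\<^sup>m\<close> continuously
  differentiable up to the endpoint 0.
\<close>

lemma nn_integral_powr_substitution:
  fixes f :: "real \<Rightarrow> real"
  assumes [measurable]: "f \<in> borel_measurable borel" and "1 < m"
  shows "(\<integral>\<^sup>+h. ennreal (f h) * indicator {0<..<1} h \<partial>lborel)
       = (\<integral>\<^sup>+r. ennreal (f (r powr m) * (m * r powr (m - 1))) * indicator {0<..<1} r \<partial>lborel)"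
proof -
  have deriv: "((\<lambda>r. r powr m) has_real_derivative m * r powr (m - 1)) (at r)"
    if "r \<in> {0..1}" for r :: real
  proof (cases "r = 0")
    case True
    \<comment> \<open>The two-sided derivative at 0 makes sense because \<open>powr\<close> is even in its base.\<close>
    have "((\<lambda>h::real. \<bar>h\<bar> powr (m - 1)) \<longlongrightarrow> \<bar>0\<bar> powr (m - 1)) (at 0)"
      using \<open>1 < m\<close> by (intro tendsto_powr' tendsto_rabs tendsto_const tendsto_ident_at) auto
    then have "((\<lambda>h::real. \<bar>h\<bar> powr (m - 1)) \<longlongrightarrow> 0) (at 0)"
      by simp
    moreover have "\<bar>h\<bar> powr (m - 1) = norm (h powr m / h)" if "h \<noteq> 0" for h
      using that by (cases "h < 0") (simp_all add: powr_diff abs_if uminus_powr_eq divide_less_0_iff not_less)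
    ultimately have "((\<lambda>h::real. norm (h powr m / h)) \<longlongrightarrow> 0) (at 0)"
      by (auto intro: Lim_transform_eventually simp: eventually_at_filter)
    then show ?thesis
      using True tendsto_norm_zero_cancel[of "\<lambda>h. h powr m / h"] by (simp add: DERIV_def)
  next
    case False
    then show ?thesis using that by (intro has_real_derivative_powr) auto
  qed
  have "(\<integral>\<^sup>+h. ennreal (f h * indicator {0<..<1} h * indicator {0 powr m..1 powr m} h) \<partial>lborel)
     = (\<integral>\<^sup>+r. ennreal (f (r powr m) * indicator {0<..<1} (r powr m) * (m * r powr (m - 1)) * indicator {0..1} r) \<partial>lborel)"
  proof (rule nn_integral_substitution[where g="\<lambda>r. r powr m" and g'="\<lambda>r. m * r powr (m - 1)"
        and f="\<lambda>h. f h * indicator {0<..<1} h" and a=0 and b=1])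
    show "continuous_on {0..1} (\<lambda>r. m * r powr (m - 1))"
      using \<open>1 < m\<close> by (intro continuous_intros continuous_on_powr') auto
    show "set_borel_measurable borel {0 powr m..1 powr m} (\<lambda>h. f h * indicator {0<..<1} h)"
      unfolding set_borel_measurable_def by measurable
  qed (use deriv \<open>1 < m\<close> in auto)
  also have "\<dots> = (\<integral>\<^sup>+r. ennreal (f (r powr m) * (m * r powr (m - 1))) * indicator {0<..<1} r \<partial>lborel)"
  proof (rule nn_integral_cong)
    fix r :: real
    have "0 < r powr m \<and> r powr m < 1" if "0 < r" "r < 1"
      using that \<open>1 < m\<close> powr_less_mono2[of m r 1] by auto
    then show "ennreal (f (r powr m) * indicator {0<..<1} (r powr m) * (m * r powr (m - 1)) * indicator {0..1} r)
      = ennreal (f (r powr m) * (m * r powr (m - 1))) * indicator {0<..<1} r"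
      by (cases "r = 0"; cases "r = 1"; cases "0 < r"; cases "r < 1") (simp_all add: indicator_def)
  qed
  finally have "(\<integral>\<^sup>+h. ennreal (f h * indicator {0<..<1} h * indicator {0 powr m..1 powr m} h) \<partial>lborel) = \<dots>" .
  moreover have "(\<integral>\<^sup>+h. ennreal (f h * indicator {0<..<1} h * indicator {0 powr m..1 powr m} h) \<partial>lborel)
      = (\<integral>\<^sup>+h. ennreal (f h) * indicator {0<..<1} h \<partial>lborel)"
    by (rule nn_integral_cong) (simp add: indicator_def)
  ultimately show ?thesis by simp
qed

lemma powr_tendsto_0_of_exponent_at_top:
  fixes r :: real
  assumes "0 < r" "r < 1" and S: "S \<longlonglongrightarrow> 1" "\<And>n. S n < (1::real)"
  shows "(\<lambda>n. r powr (1 / (1 - S n))) \<longlonglongrightarrow> 0"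
proof -
  have "(\<lambda>n. 1 - S n) \<longlonglongrightarrow> 1 - 1"
    by (intro tendsto_intros S)
  then have "filterlim (\<lambda>n. inverse (1 - S n)) at_top sequentially"
    using S(2) by (intro filterlim_inverse_at_top) auto
  then have "filterlim (\<lambda>n. ln r * inverse (1 - S n)) at_bot sequentially"
    using assms(1,2) by (intro filterlim_tendsto_neg_mult_at_bot[of _ "ln r"] tendsto_const) auto
  then have "(\<lambda>n. exp (ln r * inverse (1 - S n))) \<longlonglongrightarrow> 0"
    by (rule filterlim_compose[OF exp_at_bot])
  then show ?thesis
    using assms(1) by (simp add: powr_def divide_inverse mult.commute)
qed

lemma nn_integral_lborel_translate:
  fixes a :: "'a::euclidean_space"
  assumes [measurable]: "f \<in> borel_measurable borel"
  shows "(\<integral>\<^sup>+x. f (a + x) \<partial>lborel) = (\<integral>\<^sup>+x. f x \<partial>lborel)"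
  by (subst (2) lborel_distr_plus[of a, symmetric]) (simp add: nn_integral_distr)

section \<open>Generalized Young functions\<close>

lemma young_zero:
  assumes "generalized_Young g G" shows "G x y 0 = 0"
proof -
  have "(g x y has_integral G x y 0) {0..0}"
    using assms unfolding generalized_Young_def by (metis order.refl)
  then show ?thesis
    by (simp add: has_integral_refl has_integral_unique)
qed

text \<open>
  The density is nondecreasing, so its integral over an interval lies between the values at the
  endpoints times the length. The further estimates on \<open>G\<close> start from these two bounds.
\<close>

lemma young_increment:
  assumes G: "generalized_Young g G" and ab: "0 \<le> a" "a \<le> b"
  shows "(b - a) * g x y a \<le> G x y b - G x y a" and "G x y b - G x y a \<le> (b - a) * g x y b"
proof -
  have I: "(g x y has_integral G x y t) {0..t}" if "0 \<le> t" for t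
    using G that by (auto simp: generalized_Young_def)
  have mono: "g x y t \<le> g x y t'" if "0 \<le> t" "t \<le> t'" for t t'
    using G that unfolding generalized_Young_def mono_on_def by auto
  have int: "g x y integrable_on {a..b}"
    by (rule integrable_on_subinterval[OF has_integral_integrable[OF I[of b]]]) (use ab in auto)
  have "(g x y has_integral (G x y a + integral {a..b} (g x y))) {0..b}"
    using has_integral_combine[OF ab I[OF ab(1)] integrable_integral[OF int]] .
  then have "G x y a + integral {a..b} (g x y) = G x y b"
    using ab by (intro has_integral_unique[OF _ I[of b]]) auto
  then have D: "(g x y has_integral (G x y b - G x y a)) {a..b}"
    using integrable_integral[OF int] by (metis add_diff_cancel_left')
  show "(b - a) * g x y a \<le> G x y b - G x y a"
    using has_integral_le[OF has_integral_const_real[of "g x y a" a b] D] mono ab by auto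
  show "G x y b - G x y a \<le> (b - a) * g x y b"
    using has_integral_le[OF D has_integral_const_real[of "g x y b" a b]] mono ab by auto
qed

lemma young_density_nonneg:
  assumes "generalized_Young g G" "0 \<le> t" shows "0 \<le> g x y t"
  using assms unfolding generalized_Young_def by (cases "t = 0") (auto simp: less_imp_le)

lemma young_mono:
  assumes G: "generalized_Young g G" and "0 \<le> a" "a \<le> b" shows "G x y a \<le> G x y b"
proof -
  have "0 \<le> (b - a) * g x y a"
    using young_density_nonneg[OF assms(1,2)] assms(3) by simp
  then show ?thesis
    using young_increment(1)[OF assms, of x y] by linarith
qed

lemma young_nonneg:
  assumes "generalized_Young g G" "0 \<le> t" shows "0 \<le> G x y t"
  using young_mono[OF assms(1) order.refl assms(2)] young_zero[OF assms(1)] by metis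

text \<open>
  Convexity of \<open>G x y\<close> together with \<open>G x y 0 = 0\<close>: the average slope over \<open>[0, r t]\<close> is at most
  \<open>g x y (r t)\<close>, which is at most the average slope over \<open>[r t, t]\<close>. This linear gain in \<open>r\<close> is what
  cancels the singular weight \<open>1/r\<close> later.
\<close>

lemma young_star_shaped:
  assumes G: "generalized_Young g G" and r: "0 \<le> r" "r \<le> 1" and t: "0 \<le> t"
  shows "G x y (r * t) \<le> r * G x y t"
proof -
  have rt: "0 \<le> r * t" "r * t \<le> t"
    using r t by (auto simp: mult_left_le_one_le)
  have "G x y (r * t) \<le> r * t * g x y (r * t)"
    using young_increment(2)[OF G order.refl rt(1), of x y] by (simp add: young_zero[OF G])
  then have "(1 - r) * G x y (r * t) \<le> (1 - r) * (r * t * g x y (r * t))"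
    using r by (intro mult_left_mono) auto
  also have "\<dots> = r * ((t - r * t) * g x y (r * t))"
    by (simp add: algebra_simps)
  also have "\<dots> \<le> r * (G x y t - G x y (r * t))"
    using young_increment(1)[OF G rt, of x y] r by (intro mult_left_mono) auto
  finally show ?thesis
    by (simp add: algebra_simps)
qed

text \<open>
  The upper bound in \<open>hyp_H3\<close> is a doubling condition. The scale factor \<open>a > 1\<close> is chosen so close to
  1 that the increment of \<open>G\<close> from \<open>t\<close> to \<open>a t\<close> is at most half of \<open>G x y (a t)\<close>, hence
  \<open>G x y (a t) \<le> 2 G x y t\<close>. Starting from the bound of \<open>hyp_H1\<close> at \<open>t = 1\<close> and iterating reaches every
  \<open>T\<close>.
\<close>

lemma young_uniformly_bounded:
  assumes G: "generalized_Young g G" and "hyp_H1 G" "hyp_H3 g G"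
  shows "\<exists>B\<ge>0. \<forall>x y. \<forall>t\<in>{0..T}. G x y t \<le> B"
proof -
  obtain C where C: "G x y 1 \<le> C" "0 \<le> C" for x y
    using assms(2) unfolding hyp_H1_def by (meson less_imp_le order_trans)
  obtain p q where pq: "1 < p" "p \<le> q"
      "\<And>x y t. 0 < t \<Longrightarrow> p \<le> t * g x y t / G x y t \<and> t * g x y t / G x y t \<le> q"
    using assms(3) unfolding hyp_H3_def by blast
  define a where "a = 1 + 1 / (2 * q)"
  have q: "0 < q" and a: "1 < a"
    using pq by (auto simp: a_def)
  have doubling: "G x y (a * t) \<le> 2 * G x y t" if "0 < t" for x y t
  proof -
    have at: "t \<le> a * t" "0 < a * t"
      using that a by auto
    have "G x y (a * t) \<noteq> 0"
      using pq(1) pq(3)[OF at(2), of x y] by auto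
    then have "0 < G x y (a * t)"
      using young_nonneg[OF G, of "a * t" x y] at by linarith
    then have g: "a * t * g x y (a * t) \<le> q * G x y (a * t)"
      using pq(3)[OF at(2), of x y] by (simp add: field_simps)
    have "t * g x y (a * t) \<le> a * t * g x y (a * t)"
      using at young_density_nonneg[OF G, of "a * t" x y] by (intro mult_right_mono) auto
    with g have *: "t * g x y (a * t) \<le> q * G x y (a * t)"
      by linarith
    have "G x y (a * t) - G x y t \<le> (a * t - t) * g x y (a * t)"
      using young_increment(2)[OF G _ at(1)] that by simp
    also have "\<dots> = (1 / (2 * q)) * (t * g x y (a * t))"
      by (simp add: a_def algebra_simps)
    also have "\<dots> \<le> (1 / (2 * q)) * (q * G x y (a * t))"
      using * q by (intro mult_left_mono) auto
    also have "\<dots> = G x y (a * t) / 2"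
      using q by simp
    finally show ?thesis by simp
  qed
  have iter: "G x y (a ^ n) \<le> 2 ^ n * C" for x y n
  proof (induction n)
    case (Suc n)
    have "G x y (a ^ Suc n) \<le> 2 * G x y (a ^ n)"
      using doubling[of "a ^ n" x y] a by simp
    with Suc show ?case by simp
  qed (use C in simp)
  obtain n where "T < a ^ n"
    using real_arch_pow[OF a] by blast
  then have "G x y t \<le> 2 ^ n * C" if "t \<in> {0..T}" for x y t
    using young_mono[OF G, of t "a ^ n" x y] iter[where n=n and x=x and y=y] that by auto
  then show ?thesis
    using C(2) by (intro exI[of _ "2 ^ n * C"]) auto
qed

text \<open>
  The density at \<open>T\<close> is at most the average slope of \<open>G\<close> over \<open>[T, 2T]\<close>, which is bounded uniformly
  in \<open>(x, y)\<close>.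
\<close>

lemma young_lipschitz:
  assumes G: "generalized_Young g G" and "hyp_H1 G" "hyp_H3 g G" and "0 < T"
  shows "\<exists>L. \<forall>x y. \<forall>a\<in>{0..T}. \<forall>b\<in>{0..T}. \<bar>G x y b - G x y a\<bar> \<le> L * \<bar>b - a\<bar>"
proof -
  obtain B where B: "0 \<le> B" "\<And>x y t. t \<in> {0..2 * T} \<Longrightarrow> G x y t \<le> B"
    using young_uniformly_bounded[OF assms(1-3), of "2 * T"] by metis
  have g: "g x y T \<le> B / T" for x y
  proof -
    have "T * g x y T \<le> G x y (2 * T) - G x y T"
      using young_increment(1)[OF G, of T "2 * T" x y] \<open>0 < T\<close> by simp
    also have "\<dots> \<le> B"
      using B(2)[of "2 * T" x y] young_nonneg[OF G, of T x y] \<open>0 < T\<close> by simp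
    finally show ?thesis
      using \<open>0 < T\<close> by (simp add: field_simps)
  qed
  have *: "\<bar>G x y b - G x y a\<bar> \<le> B / T * \<bar>b - a\<bar>" if "0 \<le> a" "a \<le> b" "b \<le> T" for x y a b
  proof -
    have "g x y b \<le> g x y T"
      using G that unfolding generalized_Young_def mono_on_def by auto
    then have "(b - a) * g x y b \<le> (b - a) * (B / T)"
      using that g[of x y] by (intro mult_left_mono) auto
    then show ?thesis
      using young_increment(2)[OF G that(1,2), of x y] young_mono[OF G that(1,2), of x y] that
      by (simp add: algebra_simps)
  qed
  show ?thesis
  proof (intro exI[of _ "B / T"] allI ballI)
    fix x y a b assume "a \<in> {0..T}" "b \<in> {0..T}"
    then show "\<bar>G x y b - G x y a\<bar> \<le> B / T * \<bar>b - a\<bar>"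
      using *[of a b x y] *[of b a x y] by (cases "a \<le> b") (auto simp: abs_minus_commute)
  qed
qed

text \<open>
  Continuity in \<open>y\<close> for each \<open>t\<close> and Lipschitz continuity in \<open>t\<close> with a constant independent of \<open>y\<close>
  combine to joint continuity. The absolute value extends the function from \<open>t \<ge> 0\<close> to the whole
  line.
\<close>

lemma young_jointly_continuous:
  assumes G: "generalized_Young g G" and "hyp_H1 G" "hyp_H2 G" "hyp_H3 g G"
  shows "continuous_on UNIV (\<lambda>(y, t). G x y \<bar>t\<bar>)"
proof (rule continuous_on_sequentiallyI)
  fix z :: "nat \<Rightarrow> 'a \<times> real" and w
  assume zw: "z \<longlonglongrightarrow> w"
  define Y \<tau> where "Y n = fst (z n)" and "\<tau> n = \<bar>snd (z n)\<bar>" for n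
  define y t where "y = fst w" and "t = \<bar>snd w\<bar>"
  have y: "Y \<longlonglongrightarrow> y" and t: "\<tau> \<longlonglongrightarrow> t"
    unfolding Y_def \<tau>_def y_def t_def by (intro tendsto_intros zw)+
  have nonneg: "0 \<le> t" "0 \<le> \<tau> n" for n
    by (simp_all add: t_def \<tau>_def)
  have "0 < t + 1"
    using nonneg(1) by linarith
  then obtain L where
    L: "\<And>x y a b. a \<in> {0..t + 1} \<Longrightarrow> b \<in> {0..t + 1} \<Longrightarrow> \<bar>G x y b - G x y a\<bar> \<le> L * \<bar>b - a\<bar>"
    using young_lipschitz[OF assms(1,2,4)] by metis
  have "\<forall>\<^sub>F n in sequentially. \<tau> n < t + 1"
    using order_tendstoD(2)[OF t, of "t + 1"] by simp
  then have bound: "\<forall>\<^sub>F n in sequentially. norm (G x (Y n) (\<tau> n) - G x (Y n) t) \<le> L * \<bar>\<tau> n - t\<bar>"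
  proof eventually_elim
    case (elim n)
    show ?case
      using L[of t "\<tau> n" x "Y n"] nonneg elim by simp
  qed
  have "(\<lambda>n. L * \<bar>\<tau> n - t\<bar>) \<longlonglongrightarrow> L * \<bar>t - t\<bar>"
    by (intro tendsto_intros t)
  then have "(\<lambda>n. L * \<bar>\<tau> n - t\<bar>) \<longlonglongrightarrow> 0"
    by simp
  with bound have "(\<lambda>n. G x (Y n) (\<tau> n) - G x (Y n) t) \<longlonglongrightarrow> 0"
    by (rule Lim_null_comparison)
  moreover have "(\<lambda>n. G x (Y n) t) \<longlonglongrightarrow> G x y t"
    using assms(3) nonneg(1) unfolding hyp_H2_def
    by (intro continuous_on_tendsto_compose[OF _ y, of UNIV "\<lambda>y. G x y t"]) auto
  ultimately have "(\<lambda>n. (G x (Y n) (\<tau> n) - G x (Y n) t) + G x (Y n) t) \<longlonglongrightarrow> 0 + G x y t"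
    by (rule tendsto_add)
  then show "(\<lambda>n. case z n of (y, t) \<Rightarrow> G x y \<bar>t\<bar>) \<longlonglongrightarrow> (case w of (y, t) \<Rightarrow> G x y \<bar>t\<bar>)"
    by (simp add: Y_def \<tau>_def y_def t_def split_beta)
qed

text \<open>
  Joint measurability gives this for almost every \<open>y\<close>; such \<open>y\<close> are dense, and \<open>hyp_H2\<close> passes to the
  limit.
\<close>

lemma young_section_measurable:
  assumes G: "generalized_Young g G" and "hyp_H2 G" and "0 \<le> t"
  shows "(\<lambda>x. G x y t) \<in> borel_measurable lebesgue"
proof -
  have "(\<lambda>(x, y). G x y t) \<in> borel_measurable lebesgue"
    using G \<open>0 \<le> t\<close> by (simp add: generalized_Young_def)
  from borel_measurable_lebesgue_sections[OF this]
  have "AE y in lborel. (\<lambda>x. G x y t) \<in> borel_measurable lebesgue"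
    by simp
  then obtain Y where Y: "\<And>n. (\<lambda>x. G x (Y n) t) \<in> borel_measurable lebesgue" "Y \<longlonglongrightarrow> y"
    by (rule AE_lborel_imp_dense[where y=y]) blast
  show ?thesis
  proof (rule borel_measurable_LIMSEQ_metric[OF Y(1)])
    show "(\<lambda>n. G x (Y n) t) \<longlonglongrightarrow> G x y t" for x
      using assms(2,3) Y(2) unfolding hyp_H2_def
      by (intro continuous_on_tendsto_compose[of UNIV "\<lambda>y. G x y t"]) auto
  qed
qed

text \<open>
  The pairs \<open>(x, x - h e)\<close> form a null set as soon as the dimension exceeds 1, so joint Lebesgue
  measurability of \<open>G\<close> alone does not make the integrands of the theorem measurable. Continuity in
  \<open>(y, t)\<close> does.
\<close>

lemma young_compose_measurable:
  assumes G: "generalized_Young g G" and "hyp_H1 G" "hyp_H2 G" "hyp_H3 g G"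
    and \<xi>: "\<xi> \<in> M \<rightarrow>\<^sub>M lebesgue" and \<eta>: "\<eta> \<in> borel_measurable M" and \<tau>: "\<tau> \<in> borel_measurable M"
    and nn: "\<And>z. z \<in> space M \<Longrightarrow> 0 \<le> \<tau> z"
  shows "(\<lambda>z. G (\<xi> z) (\<eta> z) (\<tau> z)) \<in> borel_measurable M"
proof -
  have "(\<lambda>z. (\<lambda>(y, t). G (\<xi> z) y \<bar>t\<bar>) (\<eta> z, \<tau> z)) \<in> borel_measurable M"
  proof (rule borel_measurable_caratheodory_compose[where f="\<lambda>z. \<lambda>(y, t). G (\<xi> z) y \<bar>t\<bar>" and \<phi>="\<lambda>z. (\<eta> z, \<tau> z)"])
    show "(\<lambda>z. (\<lambda>(y, t). G (\<xi> z) y \<bar>t\<bar>) w) \<in> borel_measurable M" for w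
      using measurable_compose[OF \<xi> young_section_measurable[OF G assms(3), of "\<bar>snd w\<bar>" "fst w"]]
      by (simp add: split_beta)
    show "continuous_on UNIV (\<lambda>w. (\<lambda>(y, t). G (\<xi> z) y \<bar>t\<bar>) w)" for z
      by (rule young_jointly_continuous[OF assms(1-4)])
    show "(\<lambda>z. (\<eta> z, \<tau> z)) \<in> borel_measurable M"
      using \<eta> \<tau> by (rule borel_measurable_Pair)
  qed
  moreover have "(\<lambda>z. (\<lambda>(y, t). G (\<xi> z) y \<bar>t\<bar>) (\<eta> z, \<tau> z)) \<in> borel_measurable M
      \<longleftrightarrow> (\<lambda>z. G (\<xi> z) (\<eta> z) (\<tau> z)) \<in> borel_measurable M"
    by (rule measurable_cong) (simp add: nn)
  ultimately show ?thesis by blast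
qed

section \<open>Compactly supported functions of class C2\<close>

lemma C2_directional_derivative:
  assumes "u \<in> C2_compact_support"
  shows "((\<lambda>h. u (x + h *\<^sub>R axis k 1)) has_real_derivative partial_deriv k u (x + a *\<^sub>R axis k 1)) (at a)"
proof -
  have "has_partial k u (x + a *\<^sub>R axis k 1)"
    using assms by (simp add: C2_compact_support_def numeral_2_eq_2)
  then have "((\<lambda>h. u (x + a *\<^sub>R axis k 1 + h *\<^sub>R axis k 1)) has_real_derivative
      partial_deriv k u (x + a *\<^sub>R axis k 1)) (at 0)"
    by (simp add: has_partial_def partial_deriv_def DERIV_deriv_iff_field_differentiable)
  then show ?thesis
    using DERIV_shift[of "\<lambda>h. u (x + h *\<^sub>R axis k 1)" "partial_deriv k u (x + a *\<^sub>R axis k 1)" 0 a]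
    by (simp add: algebra_simps)
qed

lemma C2_support_bounded:
  assumes "u \<in> C2_compact_support"
  shows "\<exists>R. \<forall>x. R < norm x \<longrightarrow> u x = 0"
proof -
  have "bounded (closure {x. u x \<noteq> 0})"
    using assms by (simp add: C2_compact_support_def compact_imp_bounded)
  then obtain R where "\<And>x. x \<in> closure {x. u x \<noteq> 0} \<Longrightarrow> norm x \<le> R"
    unfolding bounded_iff by blast
  then show ?thesis
    using closure_subset[of "{x. u x \<noteq> 0}"] by (intro exI[of _ R]) force
qed

lemma C2_continuous:
  assumes "u \<in> C2_compact_support"
  shows "continuous_on UNIV u" and "continuous_on UNIV (partial_deriv k u)"
  using assms by (simp_all add: C2_compact_support_def numeral_2_eq_2)

lemma C2_bounded:
  assumes "u \<in> C2_compact_support"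
  shows "\<exists>M. \<forall>x. \<bar>u x\<bar> \<le> M"
proof -
  obtain R where R: "\<And>x. R < norm x \<Longrightarrow> u x = 0"
    using C2_support_bounded[OF assms] by blast
  have "bounded (u ` cball 0 R)"
    by (intro compact_imp_bounded compact_continuous_image continuous_on_subset[OF C2_continuous(1)[OF assms]]) auto
  then obtain M where M: "\<And>x. x \<in> cball 0 R \<Longrightarrow> \<bar>u x\<bar> \<le> M"
    unfolding bounded_iff by (metis image_eqI real_norm_def)
  have "\<bar>u x\<bar> \<le> max M 0" for x
    using M[of x] R[of x] by (cases "norm x \<le> R") auto
  then show ?thesis by blast
qed

text \<open>
  Beyond distance 1 from the support the difference vanishes for \<open>\<bar>h\<bar> \<le> 1\<close>; elsewhere the segment stays
  in a fixed ball, on which the partial derivative is bounded.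
\<close>

lemma C2_directional_lipschitz:
  fixes k :: "'n::finite"
  assumes u: "u \<in> C2_compact_support"
  shows "\<exists>L\<ge>0. \<forall>x h. \<bar>h\<bar> \<le> 1 \<longrightarrow> \<bar>u (x - h *\<^sub>R axis k 1) - u x\<bar> \<le> L * \<bar>h\<bar>"
proof -
  let ?e = "axis k 1 :: real^'n"
  obtain R where R: "\<And>x. R < norm x \<Longrightarrow> u x = 0"
    using C2_support_bounded[OF u] by blast
  have "bounded (partial_deriv k u ` cball 0 (R + 2))"
    by (intro compact_imp_bounded compact_continuous_image continuous_on_subset[OF C2_continuous(2)[OF u]]) auto
  then obtain L where L: "\<And>x. x \<in> cball 0 (R + 2) \<Longrightarrow> \<bar>partial_deriv k u x\<bar> \<le> L"
    unfolding bounded_iff by (metis image_eqI real_norm_def)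
  have shift: "norm (x + a *\<^sub>R ?e) \<le> norm x + \<bar>a\<bar>" "norm x \<le> norm (x + a *\<^sub>R ?e) + \<bar>a\<bar>" for x a
    using norm_triangle_ineq[of x "a *\<^sub>R ?e"] norm_triangle_ineq4[of "x + a *\<^sub>R ?e" "a *\<^sub>R ?e"] by auto
  have "\<bar>u (x - h *\<^sub>R ?e) - u x\<bar> \<le> max L 0 * \<bar>h\<bar>" if h: "\<bar>h\<bar> \<le> 1" for x h
  proof (cases "norm x \<le> R + 1")
    case True
    have "norm (u (x + (- h) *\<^sub>R ?e) - u (x + 0 *\<^sub>R ?e)) \<le> max L 0 * norm (- h - 0)"
    proof (rule field_differentiable_bound[where S="{-1..1}" and f="\<lambda>h. u (x + h *\<^sub>R ?e)"])
      fix a :: real assume a: "a \<in> {-1..1}"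
      show "((\<lambda>h. u (x + h *\<^sub>R ?e)) has_field_derivative partial_deriv k u (x + a *\<^sub>R ?e)) (at a within {-1..1})"
        by (rule has_field_derivative_at_within[OF C2_directional_derivative[OF u]])
      show "norm (partial_deriv k u (x + a *\<^sub>R ?e)) \<le> max L 0"
      proof -
        have "norm (x + a *\<^sub>R ?e) \<le> R + 2"
          using shift(1)[of x a] a True by (simp add: abs_if split: if_splits)
        then show ?thesis
          using L[of "x + a *\<^sub>R ?e"] by (simp add: le_max_iff_disj)
      qed
    qed (use h in auto)
    then show ?thesis by simp
  next
    case False
    then have "u x = 0" "u (x - h *\<^sub>R ?e) = 0"
      using R shift(2)[of x "- h"] h by auto
    then show ?thesis by simp
  qed
  then show ?thesis
    by (intro exI[of _ "max L 0"]) auto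
qed

section \<open>Measurability of the integrand\<close>

locale young_directional =
  fixes g G :: "real^'n::finite \<Rightarrow> real^'n \<Rightarrow> real \<Rightarrow> real"
    and u :: "real^'n \<Rightarrow> real"
    and k :: 'n
  assumes young: "generalized_Young g G"
    and H1: "hyp_H1 G" and H2: "hyp_H2 G" and H3: "hyp_H3 g G"
    and C2: "u \<in> C2_compact_support"
begin

abbreviation e :: "real^'n" where "e \<equiv> axis k 1"

text \<open>
  The integrand of the functional without the weight \<open>1/\<bar>h\<bar>\<close>.
\<close>

definition energy :: "real \<Rightarrow> real^'n \<Rightarrow> real \<Rightarrow> real" where
  "energy s x h = G x (x - h *\<^sub>R e) (\<bar>u (x - h *\<^sub>R e) - u x\<bar> / \<bar>h\<bar> powr s)"

lemma energy_nonneg: "0 \<le> energy s x h"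
  unfolding energy_def by (rule young_nonneg[OF young]) simp

lemma energy_eq_0: "u (x - h *\<^sub>R e) = u x \<Longrightarrow> energy s x h = 0"
  by (simp add: energy_def young_zero[OF young])

lemma u_measurable [measurable]: "u \<in> borel_measurable borel"
  using C2_continuous(1)[OF C2] by (rule borel_measurable_continuous_onI)

lemma partial_measurable [measurable]: "partial_deriv k u \<in> borel_measurable borel"
  using C2_continuous(2)[OF C2] by (rule borel_measurable_continuous_onI)

lemma energy_measurable:
  assumes \<xi>: "\<xi> \<in> M \<rightarrow>\<^sub>M lebesgue" and [measurable]: "\<eta> \<in> borel_measurable M"
  shows "(\<lambda>z. energy s (\<xi> z) (\<eta> z)) \<in> borel_measurable M"
proof -
  have id: "(\<lambda>x. x) \<in> lebesgue \<rightarrow>\<^sub>M (borel :: (real^'n) measure)"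
    by (simp add: measurable_completion)
  have [measurable]: "\<xi> \<in> borel_measurable M"
    using measurable_compose[OF \<xi> id] .
  show ?thesis
    unfolding energy_def
    by (rule young_compose_measurable[OF young H1 H2 H3 \<xi>]) auto
qed

section \<open>Small increments\<close>

text \<open>
  The integrand over \<open>0 < \<bar>h\<bar> < 1\<close>, with both signs of \<open>h\<close> collected, after the substitution
  \<open>h = r powr (1 / (1 - s))\<close>.
\<close>

definition rescaled :: "real \<Rightarrow> real^'n \<Rightarrow> real \<Rightarrow> real" where
  "rescaled s x r = (energy s x (r powr (1 / (1 - s))) + energy s x (- (r powr (1 / (1 - s))))) / r"

text \<open>
  Under \<open>h = r\<^sup>m\<close> the measure \<open>dh/h\<close> becomes \<open>m dr/r\<close>, and \<open>m = 1/(1 - s)\<close> absorbs the factor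
  \<open>1 - s\<close>.
\<close>

lemma near_integral_rescale:
  assumes "0 < s" "s < 1"
  shows "ennreal (1 - s) * (\<integral>\<^sup>+h. ennreal ((energy s x h + energy s x (- h)) / h) * indicator {0<..<1} h \<partial>lborel)
       = (\<integral>\<^sup>+r. ennreal (rescaled s x r) * indicator {0<..<1} r \<partial>lborel)"
proof -
  define m where "m = 1 / (1 - s)"
  have m: "1 < m" "(1 - s) * m = 1"
    using assms by (auto simp: m_def)
  have [measurable]: "(\<lambda>h. energy s x h) \<in> borel_measurable borel"
    using energy_measurable[of "\<lambda>_. x" borel "\<lambda>h. h"] by simp
  have "ennreal (1 - s) * (\<integral>\<^sup>+h. ennreal ((energy s x h + energy s x (- h)) / h) * indicator {0<..<1} h \<partial>lborel)
      = ennreal (1 - s) * (\<integral>\<^sup>+r. ennreal ((energy s x (r powr m) + energy s x (- (r powr m))) / r powr m * (m * r powr (m - 1))) * indicator {0<..<1} r \<partial>lborel)"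
    using m(1) by (subst nn_integral_powr_substitution[of _ m]) auto
  also have "\<dots> = (\<integral>\<^sup>+r. ennreal (1 - s) * (ennreal ((energy s x (r powr m) + energy s x (- (r powr m))) / r powr m * (m * r powr (m - 1))) * indicator {0<..<1} r) \<partial>lborel)"
    by (rule nn_integral_cmult[symmetric]) measurable
  also have "\<dots> = (\<integral>\<^sup>+r. ennreal (rescaled s x r) * indicator {0<..<1} r \<partial>lborel)"
  proof (rule nn_integral_cong)
    fix r :: real
    show "ennreal (1 - s) * (ennreal ((energy s x (r powr m) + energy s x (- (r powr m))) / r powr m * (m * r powr (m - 1))) * indicator {0<..<1} r)
        = ennreal (rescaled s x r) * indicator {0<..<1} r"
    proof (cases "0 < r \<and> r < 1")
      case True
      let ?E = "energy s x (r powr m) + energy s x (- (r powr m))"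
      have "(1 - s) * (?E / r powr m * (m * r powr (m - 1))) = ((1 - s) * m) * (?E / r powr m * r powr (m - 1))"
        by (simp add: algebra_simps)
      also have "\<dots> = ?E / r"
        using True by (simp add: m(2) powr_diff)
      finally have "(1 - s) * (?E / r powr m * (m * r powr (m - 1))) = rescaled s x r"
        by (simp add: rescaled_def m_def)
      then show ?thesis
        using True assms by (simp add: ennreal_mult'[symmetric])
    qed auto
  qed
  finally show ?thesis .
qed

text \<open>
  For small \<open>h\<close> the argument of \<open>G\<close> is at most \<open>L \<bar>h\<bar> powr (1 - s)\<close>, and the power factor can be
  pulled out of \<open>G\<close> because \<open>G\<close> is star-shaped.
\<close>

lemma energy_near_bound:
  obtains B where "0 \<le> B" "\<And>s x h. \<bar>h\<bar> \<le> 1 \<Longrightarrow> h \<noteq> 0 \<Longrightarrow> s < 1 \<Longrightarrow> energy s x h \<le> \<bar>h\<bar> powr (1 - s) * B"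
proof -
  obtain L where L: "0 \<le> L" "\<And>x h. \<bar>h\<bar> \<le> 1 \<Longrightarrow> \<bar>u (x - h *\<^sub>R e) - u x\<bar> \<le> L * \<bar>h\<bar>"
    using C2_directional_lipschitz[OF C2] by blast
  obtain B where B: "0 \<le> B" "\<And>x y t. t \<in> {0..L} \<Longrightarrow> G x y t \<le> B"
    using young_uniformly_bounded[OF young H1 H3] by metis
  have "energy s x h \<le> \<bar>h\<bar> powr (1 - s) * B" if h: "\<bar>h\<bar> \<le> 1" "h \<noteq> 0" "s < 1" for s x h
  proof -
    have "\<bar>u (x - h *\<^sub>R e) - u x\<bar> / \<bar>h\<bar> powr s \<le> L * \<bar>h\<bar> / \<bar>h\<bar> powr s"
      using L(2)[OF h(1)] by (intro divide_right_mono) auto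
    also have "\<dots> = \<bar>h\<bar> powr (1 - s) * L"
      using h by (simp add: powr_diff)
    finally have "energy s x h \<le> G x (x - h *\<^sub>R e) (\<bar>h\<bar> powr (1 - s) * L)"
      unfolding energy_def by (intro young_mono[OF young]) auto
    also have "\<dots> \<le> \<bar>h\<bar> powr (1 - s) * G x (x - h *\<^sub>R e) L"
      using h L(1) powr_mono2[of "1 - s" "\<bar>h\<bar>" 1] by (intro young_star_shaped[OF young]) auto
    also have "\<dots> \<le> \<bar>h\<bar> powr (1 - s) * B"
      using B(2) L(1) by (intro mult_left_mono) auto
    finally show ?thesis .
  qed
  with B(1) that show thesis by blast
qed

text \<open>
  In the new variable the gain \<open>h powr (1 - s)\<close> is exactly \<open>r\<close> and cancels the weight \<open>1/r\<close>. The
  resulting constant is a dominating function that is independent of \<open>s\<close>.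
\<close>

lemma rescaled_bound:
  obtains B where "0 \<le> B" "\<And>s x r. 0 < r \<Longrightarrow> r < 1 \<Longrightarrow> s < 1 \<Longrightarrow> rescaled s x r \<le> B"
proof -
  obtain B where B: "0 \<le> B" "\<And>s x h. \<bar>h\<bar> \<le> 1 \<Longrightarrow> h \<noteq> 0 \<Longrightarrow> s < 1 \<Longrightarrow> energy s x h \<le> \<bar>h\<bar> powr (1 - s) * B"
    using energy_near_bound by metis
  have "rescaled s x r \<le> 2 * B" if r: "0 < r" "r < 1" "s < 1" for s x r
  proof -
    define h where "h = r powr (1 / (1 - s))"
    have h: "0 < h" "h \<le> 1" "h powr (1 - s) = r"
      using r powr_mono2[of "1 / (1 - s)" r 1] by (auto simp: h_def powr_powr)
    have "energy s x h + energy s x (- h) \<le> r * B + r * B"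
      using B(2)[of h s x] B(2)[of "- h" s x] h r by (intro add_mono) auto
    then have "rescaled s x r \<le> (r * B + r * B) / r"
      using r unfolding rescaled_def h_def[symmetric] by (intro divide_right_mono) auto
    then show ?thesis using r by simp
  qed
  with B(1) that[of "2 * B"] show thesis by simp
qed

text \<open>
  The condition on \<open>r\<close> says that the argument of \<open>G\<close> is \<open>r\<close> times the absolute difference quotient
  of \<open>u\<close>, so joint continuity of \<open>G\<close> in its last two arguments gives the limit.
\<close>

lemma energy_blow_up_limit:
  assumes h: "h \<longlonglongrightarrow> 0" "\<And>n. h n \<noteq> 0" and r: "\<And>n. \<bar>h n\<bar> powr (1 - S n) = r"
  shows "(\<lambda>n. energy (S n) x (h n)) \<longlonglongrightarrow> G x x (\<bar>partial_deriv k u x\<bar> * r)"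
proof -
  have "0 \<le> r"
    using r[of 0] powr_ge_zero[of "\<bar>h 0\<bar>" "1 - S 0"] by simp
  have "((\<lambda>a. (u (x + a *\<^sub>R e) - u x) / a) \<longlongrightarrow> partial_deriv k u x) (at 0)"
    using C2_directional_derivative[OF C2, of x k 0] by (simp add: DERIV_def)
  moreover have "filterlim (\<lambda>n. - h n) (at 0) sequentially"
    using tendsto_minus[OF h(1)] h(2) by (simp add: filterlim_at)
  ultimately have "(\<lambda>n. (u (x + (- h n) *\<^sub>R e) - u x) / (- h n)) \<longlonglongrightarrow> partial_deriv k u x"
    by (rule filterlim_compose)
  then have "(\<lambda>n. \<bar>(u (x + (- h n) *\<^sub>R e) - u x) / (- h n)\<bar> * r) \<longlonglongrightarrow> \<bar>partial_deriv k u x\<bar> * r"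
    by (intro tendsto_intros)
  moreover have "\<bar>(u (x + (- h n) *\<^sub>R e) - u x) / (- h n)\<bar> * r
      = \<bar>u (x - h n *\<^sub>R e) - u x\<bar> / \<bar>h n\<bar> powr S n" for n
    using h(2)[of n] r[of n, symmetric] by (simp add: powr_diff abs_divide)
  ultimately have t: "(\<lambda>n. \<bar>u (x - h n *\<^sub>R e) - u x\<bar> / \<bar>h n\<bar> powr S n) \<longlonglongrightarrow> \<bar>partial_deriv k u x\<bar> * r"
    by simp
  have y: "(\<lambda>n. x - h n *\<^sub>R e) \<longlonglongrightarrow> x - 0 *\<^sub>R e"
    by (intro tendsto_intros h)
  have "(\<lambda>n. (\<lambda>(y, t). G x y \<bar>t\<bar>) (x - h n *\<^sub>R e, \<bar>u (x - h n *\<^sub>R e) - u x\<bar> / \<bar>h n\<bar> powr S n))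
      \<longlonglongrightarrow> (\<lambda>(y, t). G x y \<bar>t\<bar>) (x - 0 *\<^sub>R e, \<bar>partial_deriv k u x\<bar> * r)"
    by (rule continuous_on_tendsto_compose[OF young_jointly_continuous[OF young H1 H2 H3]])
       (auto intro: tendsto_Pair t y simp del: scaleR_zero_left)
  then show ?thesis
    using \<open>0 \<le> r\<close> by (simp add: energy_def)
qed

lemma rescaled_limit:
  assumes S: "S \<longlonglongrightarrow> 1" "\<And>n. S n < 1" and r: "0 < r" "r < 1"
  shows "(\<lambda>n. rescaled (S n) x r) \<longlonglongrightarrow> 2 * (G x x (\<bar>partial_deriv k u x\<bar> * r) / r)"
proof -
  define h where "h n = r powr (1 / (1 - S n))" for n
  have h: "h \<longlonglongrightarrow> 0" "h n > 0" "h n powr (1 - S n) = r" for n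
    using powr_tendsto_0_of_exponent_at_top[OF r S] r S(2)[of n] by (auto simp: h_def[abs_def] powr_powr)
  have "(\<lambda>n. energy (S n) x (h n)) \<longlonglongrightarrow> G x x (\<bar>partial_deriv k u x\<bar> * r)"
    using h by (intro energy_blow_up_limit) (auto simp: less_imp_neq[symmetric] less_imp_le)
  moreover have "(\<lambda>n. energy (S n) x (- h n)) \<longlonglongrightarrow> G x x (\<bar>partial_deriv k u x\<bar> * r)"
    using h tendsto_minus[OF h(1)] by (intro energy_blow_up_limit) (auto simp: less_imp_neq[symmetric] less_imp_le)
  ultimately have "(\<lambda>n. (energy (S n) x (h n) + energy (S n) x (- h n)) / r)
      \<longlonglongrightarrow> (G x x (\<bar>partial_deriv k u x\<bar> * r) + G x x (\<bar>partial_deriv k u x\<bar> * r)) / r"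
    using r by (intro tendsto_intros) auto
  then show ?thesis
    by (simp add: rescaled_def h_def)
qed

text \<open>
  Dominated convergence on the product space. Outside a ball of radius \<open>R + 1\<close>, where \<open>u\<close> vanishes
  beyond \<open>R\<close>, the integrands are zero, so a constant times the indicator of a set of finite measure
  dominates.
\<close>

lemma near_limit:
  assumes S: "S \<longlonglongrightarrow> 1" "\<And>n. S n < 1"
  shows "(\<lambda>n. \<integral>\<^sup>+x. \<integral>\<^sup>+r. ennreal (rescaled (S n) x r) * indicator {0<..<1} r \<partial>lborel \<partial>lebesgue)
       \<longlonglongrightarrow> (\<integral>\<^sup>+x. H0 G x \<bar>partial_deriv k u x\<bar> \<partial>lebesgue)"
proof -
  let ?M = "lebesgue \<Otimes>\<^sub>M lborel :: ((real^'n) \<times> real) measure"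
  let ?f = "\<lambda>n z. ennreal (rescaled (S n) (fst z) (snd z)) * indicator {0<..<1} (snd z)"
  let ?f' = "\<lambda>z. ennreal (2 * (G (fst z) (fst z) (\<bar>partial_deriv k u (fst z)\<bar> * \<bar>snd z\<bar>) / snd z)) * indicator {0<..<1} (snd z)"
  obtain B where B: "0 \<le> B" "\<And>s x r. 0 < r \<Longrightarrow> r < 1 \<Longrightarrow> s < 1 \<Longrightarrow> rescaled s x r \<le> B"
    using rescaled_bound by metis
  obtain R where R: "\<And>x. R < norm x \<Longrightarrow> u x = 0"
    using C2_support_bounded[OF C2] by blast
  let ?w = "\<lambda>z::(real^'n) \<times> real. ennreal B * indicator (cball 0 (R + 1)) (fst z) * indicator {0<..<1} (snd z)"
  have id: "(\<lambda>x. x) \<in> lebesgue \<rightarrow>\<^sub>M (borel :: (real^'n) measure)"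
    by (simp add: measurable_completion)
  have [measurable]: "fst \<in> ?M \<rightarrow>\<^sub>M borel"
    using measurable_compose[OF measurable_fst id] .
  have [measurable]: "(\<lambda>z. energy s (fst z) (snd z powr c)) \<in> borel_measurable ?M"
      "(\<lambda>z. energy s (fst z) (- (snd z powr c))) \<in> borel_measurable ?M" for s c
    by (rule energy_measurable; measurable)+
  have [measurable]: "?f n \<in> borel_measurable ?M" for n
    unfolding rescaled_def by measurable
  have "(\<lambda>z. G (fst z) (fst z) (\<bar>partial_deriv k u (fst z)\<bar> * \<bar>snd z\<bar>)) \<in> borel_measurable ?M"
    by (rule young_compose_measurable[OF young H1 H2 H3 measurable_fst]) auto
  then have [measurable]: "?f' \<in> borel_measurable ?M"
    by measurable
  have [measurable]: "(\<lambda>z. indicator (cball 0 (R + 1)) (fst z) :: ennreal) \<in> borel_measurable ?M"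
    by (rule measurable_compose[of fst _ borel, OF _ borel_measurable_indicator[OF borel_closed[OF closed_cball]]]) measurable
  have [measurable]: "?w \<in> borel_measurable ?M"
    by measurable
  have "(\<lambda>n. \<integral>\<^sup>+z. ?f n z \<partial>?M) \<longlonglongrightarrow> (\<integral>\<^sup>+z. ?f' z \<partial>?M)"
  proof (rule nn_integral_dominated_convergence)
    show "AE z in ?M. ?f n z \<le> ?w z" for n
    proof (rule AE_I2)
      fix z :: "(real^'n) \<times> real"
      have "rescaled (S n) (fst z) (snd z) = 0" if far: "R + 1 < norm (fst z)" and r: "0 < snd z" "snd z < 1"
      proof -
        have "energy (S n) (fst z) h = 0" if "\<bar>h\<bar> \<le> 1" for h
        proof (rule energy_eq_0)
          have "norm (fst z) \<le> norm (fst z - h *\<^sub>R e) + norm (h *\<^sub>R e)"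
            using norm_triangle_ineq[of "fst z - h *\<^sub>R e" "h *\<^sub>R e"] by simp
          then show "u (fst z - h *\<^sub>R e) = u (fst z)"
            using far that R[of "fst z - h *\<^sub>R e"] R[of "fst z"] by simp
        qed
        moreover have "snd z powr (1 / (1 - S n)) \<le> 1"
          using r S(2)[of n] powr_mono2[of "1 / (1 - S n)" "snd z" 1] by simp
        ultimately show ?thesis
          by (simp add: rescaled_def)
      qed
      then show "?f n z \<le> ?w z"
        using B(2)[of "snd z" "S n" "fst z"] S(2)[of n]
        by (auto simp: ennreal_leI not_le split: split_indicator)
    qed
    have "(\<integral>\<^sup>+z. ?w z \<partial>?M) = (\<integral>\<^sup>+x. \<integral>\<^sup>+r. ?w (x, r) \<partial>lborel \<partial>lebesgue)"
      by (rule lborel.nn_integral_fst[where f="?w", symmetric]) measurable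
    also have "\<dots> = ennreal B * emeasure lebesgue (cball 0 (R + 1) :: (real^'n) set)"
      by (simp add: nn_integral_cmult nn_integral_cmult_indicator)
    also have "\<dots> < \<infinity>"
      using emeasure_lborel_cball_finite[of "0 :: real^'n" "R + 1"] by (simp add: ennreal_mult_less_top)
    finally show "(\<integral>\<^sup>+z. ?w z \<partial>?M) < \<infinity>" .
    show "AE z in ?M. (\<lambda>n. ?f n z) \<longlonglongrightarrow> ?f' z"
    proof (rule AE_I2)
      fix z :: "(real^'n) \<times> real"
      show "(\<lambda>n. ?f n z) \<longlonglongrightarrow> ?f' z"
        using rescaled_limit[OF S, of "snd z" "fst z"]
        by (auto split: split_indicator intro: tendsto_ennrealI)
    qed
  qed measurable
  moreover have "(\<integral>\<^sup>+z. ?f n z \<partial>?M) = (\<integral>\<^sup>+x. \<integral>\<^sup>+r. ennreal (rescaled (S n) x r) * indicator {0<..<1} r \<partial>lborel \<partial>lebesgue)" for n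
    by (subst lborel.nn_integral_fst[symmetric]) auto
  moreover have "(\<integral>\<^sup>+z. ?f' z \<partial>?M) = (\<integral>\<^sup>+x. H0 G x \<bar>partial_deriv k u x\<bar> \<partial>lebesgue)"
  proof (subst lborel.nn_integral_fst[symmetric], measurable, rule nn_integral_cong)
    fix x
    have "(\<lambda>r. G x x (\<bar>partial_deriv k u x\<bar> * \<bar>r\<bar>)) \<in> borel_measurable borel"
      by (rule young_compose_measurable[OF young H1 H2 H3]) auto
    then have [measurable]: "(\<lambda>r. ennreal (G x x (\<bar>partial_deriv k u x\<bar> * \<bar>r\<bar>) / r) * indicator {0<..<1} r) \<in> borel_measurable lborel"
      by measurable
    have "(\<integral>\<^sup>+r. ?f' (x, r) \<partial>lborel)
        = (\<integral>\<^sup>+r. 2 * (ennreal (G x x (\<bar>partial_deriv k u x\<bar> * \<bar>r\<bar>) / r) * indicator {0<..<1} r) \<partial>lborel)"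
      by (intro nn_integral_cong) (simp add: ennreal_mult' mult.assoc del: times_divide_eq_right)
    also have "\<dots> = 2 * (\<integral>\<^sup>+r. ennreal (G x x (\<bar>partial_deriv k u x\<bar> * \<bar>r\<bar>) / r) * indicator {0<..<1} r \<partial>lborel)"
      by (rule nn_integral_cmult) measurable
    also have "\<dots> = H0 G x \<bar>partial_deriv k u x\<bar>"
      unfolding H0_def nn_integral_completion
      by (intro arg_cong[where f="\<lambda>a. 2 * a"] nn_integral_cong) (auto split: split_indicator)
    finally show "(\<integral>\<^sup>+r. ?f' (x, r) \<partial>lborel) = H0 G x \<bar>partial_deriv k u x\<bar>" .
  qed
  ultimately show ?thesis by simp
qed

section \<open>Large increments\<close>

text \<open>
  Here \<open>\<bar>h\<bar> powr (- s) \<le> 1\<close> is pulled out of \<open>G\<close>, whose argument is then bounded by the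
  oscillation of \<open>u\<close>. One of the two points has to lie in the support.
\<close>

lemma energy_far_bound:
  obtains B R where "0 \<le> B" "\<And>s x h. 1 \<le> \<bar>h\<bar> \<Longrightarrow> 1/2 < s \<Longrightarrow>
    energy s x h \<le> \<bar>h\<bar> powr (-1/2) * B * (indicator (cball 0 R) x + indicator (cball 0 R) (x - h *\<^sub>R e))"
proof -
  obtain M where M: "\<And>x. \<bar>u x\<bar> \<le> M"
    using C2_bounded[OF C2] by blast
  obtain R where R: "\<And>x. R < norm x \<Longrightarrow> u x = 0"
    using C2_support_bounded[OF C2] by blast
  obtain B where B: "0 \<le> B" "\<And>x y t. t \<in> {0..2 * M} \<Longrightarrow> G x y t \<le> B"
    using young_uniformly_bounded[OF young H1 H3] by metis
  have "energy s x h \<le> \<bar>h\<bar> powr (-1/2) * B * (indicator (cball 0 R) x + indicator (cball 0 R) (x - h *\<^sub>R e))"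
    if h: "1 \<le> \<bar>h\<bar>" "1/2 < s" for s x h
  proof (cases "x \<in> cball 0 R \<or> x - h *\<^sub>R e \<in> cball 0 R")
    case True
    have d: "\<bar>u (x - h *\<^sub>R e) - u x\<bar> \<in> {0..2 * M}"
      using M[of x] M[of "x - h *\<^sub>R e"] by auto
    have p: "\<bar>h\<bar> powr (- s) \<le> \<bar>h\<bar> powr (-1/2)" "\<bar>h\<bar> powr (- s) \<le> 1"
      using h powr_mono[of "- s" "-1/2" "\<bar>h\<bar>"] powr_mono[of "- s" 0 "\<bar>h\<bar>"] by (auto split: if_splits)
    have "energy s x h = G x (x - h *\<^sub>R e) (\<bar>h\<bar> powr (- s) * \<bar>u (x - h *\<^sub>R e) - u x\<bar>)"
      by (simp add: energy_def powr_minus_divide)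
    also have "\<dots> \<le> \<bar>h\<bar> powr (- s) * G x (x - h *\<^sub>R e) \<bar>u (x - h *\<^sub>R e) - u x\<bar>"
      using p by (intro young_star_shaped[OF young]) auto
    also have "\<dots> \<le> \<bar>h\<bar> powr (-1/2) * B"
      using p B(2)[OF d] young_nonneg[OF young, of "\<bar>u (x - h *\<^sub>R e) - u x\<bar>"] by (intro mult_mono) auto
    also have "\<dots> \<le> \<bar>h\<bar> powr (-1/2) * B * (indicator (cball 0 R) x + indicator (cball 0 R) (x - h *\<^sub>R e))"
    proof -
      have "1 \<le> (indicator (cball 0 R) x + indicator (cball 0 R) (x - h *\<^sub>R e) :: real)"
        using True by (auto simp: indicator_def)
      then show ?thesis
        using mult_left_mono[of 1 _ "\<bar>h\<bar> powr (-1/2) * B"] B(1) by fastforce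
    qed
    finally show ?thesis .
  next
    case False
    then have "energy s x h = 0"
      using R[of x] R[of "x - h *\<^sub>R e"] by (intro energy_eq_0) auto
    then show ?thesis using B(1) by simp
  qed
  with B(1) that show thesis by blast
qed

text \<open>
  Integrating first over \<open>x\<close>, translation invariance gives a multiple of the volume of the ball, and
  \<open>h powr (-3/2)\<close> is integrable over \<open>[1, \<infinity>)\<close>. The restriction \<open>s > 1/2\<close> makes the bound uniform.
\<close>

lemma far_integral_bounded:
  obtains C where "C < (\<infinity>::ennreal)"
    "\<And>s. 1/2 < s \<Longrightarrow> (\<integral>\<^sup>+x. \<integral>\<^sup>+h. ennreal ((energy s x h + energy s x (- h)) / h) * indicator {1..} h \<partial>lborel \<partial>lebesgue) \<le> C"
proof -
  obtain B R where B: "0 \<le> B" "\<And>s x h. 1 \<le> \<bar>h\<bar> \<Longrightarrow> 1/2 < s \<Longrightarrow>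
    energy s x h \<le> \<bar>h\<bar> powr (-1/2) * B * (indicator (cball 0 R) x + indicator (cball 0 R) (x - h *\<^sub>R e))"
    using energy_far_bound by metis
  let ?K = "cball 0 R :: (real^'n) set"
  define \<kappa> :: "real^'n \<Rightarrow> ennreal" where "\<kappa> = indicator ?K"
  have [measurable]: "\<kappa> \<in> borel_measurable borel" and \<kappa>: "(\<integral>\<^sup>+x. \<kappa> x \<partial>lborel) = emeasure lborel ?K"
    unfolding \<kappa>_def by (simp_all add: borel_measurable_indicator borel_closed)
  let ?c = "\<lambda>x h. 2 * \<kappa> x + \<kappa> (x - h *\<^sub>R e) + \<kappa> (x + h *\<^sub>R e)"
  let ?p = "\<lambda>h::real. ennreal (B * h powr (-3/2)) * indicator {1..} h"
  define C where "C = (\<integral>\<^sup>+x. \<integral>\<^sup>+h. ?p h * ?c x h \<partial>lborel \<partial>lborel)"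
  have tail: "(\<integral>\<^sup>+h. ennreal (h powr (-3/2)) * indicator {1..} h \<partial>lborel) = ennreal (0 - (-2))"
  proof -
    have "((\<lambda>h::real. -2 * h powr (-1/2)) \<longlongrightarrow> -2 * 0) at_top"
      by (intro tendsto_mult tendsto_const tendsto_neg_powr filterlim_ident) auto
    then have "(\<integral>\<^sup>+h. ennreal (h powr (-3/2)) * indicator {1..} h \<partial>lborel) = ennreal (0 - (-2 * 1 powr (-1/2)))"
      by (intro nn_integral_FTC_atLeast[where F="\<lambda>h. -2 * h powr (-1/2)"])
         (auto intro!: derivative_eq_intros)
    then show ?thesis by simp
  qed
  have "C = (\<integral>\<^sup>+h. \<integral>\<^sup>+x. ?p h * ?c x h \<partial>lborel \<partial>lborel)"
    unfolding C_def by (rule lborel_pair.Fubini'[symmetric]) measurable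
  also have "\<dots> = (\<integral>\<^sup>+h. ?p h * (4 * emeasure lborel ?K) \<partial>lborel)"
  proof (rule nn_integral_cong)
    fix h :: real
    have 1: "(\<integral>\<^sup>+x. \<kappa> (x - h *\<^sub>R e) \<partial>lborel) = emeasure lborel ?K"
      using nn_integral_lborel_translate[of \<kappa> "- (h *\<^sub>R e)"] by (simp add: \<kappa> algebra_simps)
    have 2: "(\<integral>\<^sup>+x. \<kappa> (x + h *\<^sub>R e) \<partial>lborel) = emeasure lborel ?K"
      using nn_integral_lborel_translate[of \<kappa> "h *\<^sub>R e"] by (simp add: \<kappa> algebra_simps)
    have "(\<integral>\<^sup>+x. ?p h * ?c x h \<partial>lborel) = ?p h * (\<integral>\<^sup>+x. ?c x h \<partial>lborel)"
      by (rule nn_integral_cmult) measurable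
    also have "(\<integral>\<^sup>+x. ?c x h \<partial>lborel) = 2 * emeasure lborel ?K + emeasure lborel ?K + emeasure lborel ?K"
      by (simp add: nn_integral_add nn_integral_cmult \<kappa> 1 2)
    also have "\<dots> = 4 * emeasure lborel ?K"
    proof -
      have "2 * a + a + a = (2 + 1 + 1) * a" for a :: ennreal
        by (simp only: distrib_right mult_1_left)
      then show ?thesis by simp
    qed
    finally show "(\<integral>\<^sup>+x. ?p h * ?c x h \<partial>lborel) = ?p h * (4 * emeasure lborel ?K)" .
  qed
  also have "\<dots> = (\<integral>\<^sup>+h. ennreal B * (4 * emeasure lborel ?K) * (ennreal (h powr (-3/2)) * indicator {1..} h) \<partial>lborel)"
    using B(1) by (intro nn_integral_cong) (simp add: ennreal_mult' mult_ac)
  also have "\<dots> = ennreal B * (4 * emeasure lborel ?K) * ennreal (0 - (-2))"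
    by (simp only: tail[symmetric]) (rule nn_integral_cmult, measurable)
  also have "\<dots> < \<infinity>"
    using emeasure_lborel_cball_finite[of "0 :: real^'n" R] by (simp add: ennreal_mult_less_top)
  finally have "C < \<infinity>" .
  moreover have "(\<integral>\<^sup>+x. \<integral>\<^sup>+h. ennreal ((energy s x h + energy s x (- h)) / h) * indicator {1..} h \<partial>lborel \<partial>lebesgue) \<le> C"
    if s: "1/2 < s" for s
    unfolding C_def nn_integral_completion
  proof (intro nn_integral_mono)
    fix x and h :: real
    show "ennreal ((energy s x h + energy s x (- h)) / h) * indicator {1..} h \<le> ?p h * ?c x h"
    proof (cases "1 \<le> h")
      case True
      let ?i = "\<lambda>y. indicator ?K y :: real"
      have "energy s x h + energy s x (- h)
          \<le> h powr (-1/2) * B * (2 * ?i x + ?i (x - h *\<^sub>R e) + ?i (x + h *\<^sub>R e))"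
        using B(2)[of h s x] B(2)[of "- h" s x] True s by (simp add: algebra_simps)
      then have "(energy s x h + energy s x (- h)) / h
          \<le> h powr (-1/2) * B * (2 * ?i x + ?i (x - h *\<^sub>R e) + ?i (x + h *\<^sub>R e)) / h"
        using True by (intro divide_right_mono) auto
      also have "\<dots> = B * (h powr (-1/2) / h) * (2 * ?i x + ?i (x - h *\<^sub>R e) + ?i (x + h *\<^sub>R e))"
        by simp
      also have "h powr (-1/2) / h = h powr (-3/2)"
        using True powr_diff[of h "-1/2" 1] by simp
      finally have "ennreal ((energy s x h + energy s x (- h)) / h)
          \<le> ennreal (B * h powr (-3/2) * (2 * ?i x + ?i (x - h *\<^sub>R e) + ?i (x + h *\<^sub>R e)))"
        by (rule ennreal_leI)
      also have "\<dots> = ennreal (B * h powr (-3/2)) * ?c x h"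
        using B(1) by (subst ennreal_mult) (auto simp: \<kappa>_def ennreal_plus[symmetric] ennreal_indicator simp del: ennreal_plus split: split_indicator)
      finally show ?thesis using True by simp
    qed simp
  qed
  ultimately show thesis using that by blast
qed

section \<open>The limit of the functional\<close>

lemma J_functional_split:
  assumes "0 < s" "s < 1"
  shows "ennreal (1 - s) * J_functional G k s u
    = (\<integral>\<^sup>+x. \<integral>\<^sup>+r. ennreal (rescaled s x r) * indicator {0<..<1} r \<partial>lborel \<partial>lebesgue)
    + ennreal (1 - s) * (\<integral>\<^sup>+x. \<integral>\<^sup>+h. ennreal ((energy s x h + energy s x (- h)) / h) * indicator {1..} h \<partial>lborel \<partial>lebesgue)"
proof -
  let ?E = "\<lambda>x h. ennreal ((energy s x h + energy s x (- h)) / h)"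
  let ?N = "\<lambda>x. \<integral>\<^sup>+h. ?E x h * indicator {0<..<1} h \<partial>lborel"
  let ?F = "\<lambda>x. \<integral>\<^sup>+h. ?E x h * indicator {1..} h \<partial>lborel"
  have [measurable]: "(\<lambda>z. energy s (fst z) (snd z)) \<in> borel_measurable (lebesgue \<Otimes>\<^sub>M lborel)"
      "(\<lambda>z. energy s (fst z) (- snd z)) \<in> borel_measurable (lebesgue \<Otimes>\<^sub>M lborel)"
    by (rule energy_measurable; measurable)+
  have N: "?N \<in> borel_measurable lebesgue"
    by (rule lborel.borel_measurable_nn_integral) (simp add: split_beta)
  have F: "?F \<in> borel_measurable lebesgue"
    by (rule lborel.borel_measurable_nn_integral) (simp add: split_beta)
  have inner: "(\<integral>\<^sup>+h. ennreal (energy s x h / \<bar>h\<bar>) \<partial>lborel) = ?N x + ?F x" for x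
  proof -
    have [measurable]: "(\<lambda>h. energy s x h) \<in> borel_measurable borel"
      using energy_measurable[of "\<lambda>_. x" borel "\<lambda>h. h"] by simp
    have "(\<integral>\<^sup>+h. ennreal (energy s x h / \<bar>h\<bar>) \<partial>lborel)
        = (\<integral>\<^sup>+h. (ennreal (energy s x h / \<bar>h\<bar>) + ennreal (energy s x (- h) / \<bar>- h\<bar>)) * indicator {0<..} h \<partial>lborel)"
      by (rule nn_integral_reflect) measurable
    also have "\<dots> = (\<integral>\<^sup>+h. ?E x h * indicator {0<..<1} h + ?E x h * indicator {1..} h \<partial>lborel)"
      by (intro nn_integral_cong)
         (auto simp: energy_nonneg ennreal_plus[symmetric] add_divide_distrib simp del: ennreal_plus split: split_indicator)
    also have "\<dots> = ?N x + ?F x"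
      by (rule nn_integral_add) measurable
    finally show ?thesis .
  qed
  have "J_functional G k s u = (\<integral>\<^sup>+x. \<integral>\<^sup>+h. ennreal (energy s x h / \<bar>h\<bar>) \<partial>lborel \<partial>lebesgue)"
    by (simp add: J_functional_def energy_def nn_integral_completion)
  also have "\<dots> = (\<integral>\<^sup>+x. ?N x \<partial>lebesgue) + (\<integral>\<^sup>+x. ?F x \<partial>lebesgue)"
    unfolding inner by (rule nn_integral_add[OF N F])
  finally have "ennreal (1 - s) * J_functional G k s u
      = (\<integral>\<^sup>+x. ennreal (1 - s) * ?N x \<partial>lebesgue) + ennreal (1 - s) * (\<integral>\<^sup>+x. ?F x \<partial>lebesgue)"
    by (simp add: distrib_left nn_integral_cmult[OF N])
  then show ?thesis
    by (simp add: near_integral_rescale[OF assms])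
qed

lemma J_functional_limit:
  "((\<lambda>s. ennreal (1 - s) * J_functional G k s u) \<longlongrightarrow>
      (\<integral>\<^sup>+x. H0 G x \<bar>partial_deriv k u x\<bar> \<partial>lebesgue)) (at_left 1)"
proof (rule tendsto_at_left_sequentially[of "1/2"])
  fix S :: "nat \<Rightarrow> real"
  assume S: "\<And>n. S n < 1" "\<And>n. 1/2 < S n" "S \<longlonglongrightarrow> 1"
  let ?A = "\<lambda>n. \<integral>\<^sup>+x. \<integral>\<^sup>+r. ennreal (rescaled (S n) x r) * indicator {0<..<1} r \<partial>lborel \<partial>lebesgue"
  let ?F = "\<lambda>n. \<integral>\<^sup>+x. \<integral>\<^sup>+h. ennreal ((energy (S n) x h + energy (S n) x (- h)) / h) * indicator {1..} h \<partial>lborel \<partial>lebesgue"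
  obtain C where C: "C < (\<infinity>::ennreal)" and
    "\<And>s. 1/2 < s \<Longrightarrow> (\<integral>\<^sup>+x. \<integral>\<^sup>+h. ennreal ((energy s x h + energy s x (- h)) / h) * indicator {1..} h \<partial>lborel \<partial>lebesgue) \<le> C"
    by (rule far_integral_bounded) blast
  then have far: "?F n \<le> C" for n
    using S(2)[of n] by blast
  have "(\<lambda>n. ennreal (1 - S n)) \<longlonglongrightarrow> ennreal (1 - 1)"
    by (intro tendsto_intros S(3))
  then have "(\<lambda>n. C * ennreal (1 - S n)) \<longlonglongrightarrow> C * ennreal (1 - 1)"
    using C by (intro ennreal_tendsto_cmult) auto
  then have majorant: "(\<lambda>n. ennreal (1 - S n) * C) \<longlonglongrightarrow> 0"
    by (simp add: mult.commute)
  have "(\<lambda>n. ennreal (1 - S n) * ?F n) \<longlonglongrightarrow> 0"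
  proof (rule tendsto_sandwich[OF _ _ tendsto_const majorant])
    show "\<forall>\<^sub>F n in sequentially. ennreal (1 - S n) * ?F n \<le> ennreal (1 - S n) * C"
      using far by (intro always_eventually allI mult_left_mono) auto
  qed simp
  then have "(\<lambda>n. ?A n + ennreal (1 - S n) * ?F n) \<longlonglongrightarrow> (\<integral>\<^sup>+x. H0 G x \<bar>partial_deriv k u x\<bar> \<partial>lebesgue) + 0"
    using near_limit[OF S(3,1)] by (rule tendsto_add[rotated])
  moreover have "0 < S n" for n
    using S(2)[of n] by linarith
  ultimately show "(\<lambda>n. ennreal (1 - S n) * J_functional G k (S n) u)
      \<longlonglongrightarrow> (\<integral>\<^sup>+x. H0 G x \<bar>partial_deriv k u x\<bar> \<partial>lebesgue)"
    by (simp add: J_functional_split S(1))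
qed simp

end

theorem theorem5p1:
  fixes g G :: "real^'n::finite \<Rightarrow> real^'n \<Rightarrow> real \<Rightarrow> real"
    and u :: "real^'n \<Rightarrow> real"
    and k :: 'n
  assumes "generalized_Young g G"
    and "hyp_H1 G"
    and "hyp_H2 G"
    and "hyp_H3 g G"
    and "u \<in> C2_compact_support"
  shows "((\<lambda>s. ennreal (1 - s) * J_functional G k s u) \<longlongrightarrow>
            (\<integral>\<^sup>+x. H0 G x \<bar>partial_deriv k u x\<bar> \<partial>lebesgue)) (at_left 1)"
proof -
  interpret young_directional g G u k
    using assms by unfold_locales
  show ?thesis by (rule J_functional_limit)
qed

end
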